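(* For any integers $s\ge 2$ and $n\ge k+1$ (with $k\ge 1$), $$ex(n,K_s,\mathcal{L}_{n,k})=\max\left\{\binom{k}{s},\ \binom{\left\lceil\frac{k+1}{2}\right\rceil}{s}+\left(n-\left\lceil\frac{k+1}{2}\right\rceil\right)\binom{\left\lfloor\frac{k-1}{2}\right\rfloor}{s-1}\right\}.$$
   Context: All graphs are simple. For a family of graphs $\mathcal{F}$, a graph $G$ is $\mathcal{F}$-free if no subgraph of $G$ is isomorphic to a member of $\mathcal{F}$. For a graph $T$, $ex(n,T,\mathcal{F})$ denotes the maximum number of (not necessarily induced) copies of $T$ in an $\mathcal{F}$-free graph on $n$ vertices. A linear forest is a graph whose connected components are all paths or isolated vertices. $\mathcal{L}_{n,k}$ denotes the family of all linear forests on $n$ vertices with exactly $k$ edges. $K_s$ is the complete graph on $s$ vertices. *)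

theory Defs
  imports Complex_Main
begin

text \<open>Graphs are pairs of a vertex set and a set of edges; an edge is a two-element set of vertices.\<close>

type_synonym 'a sgraph = "'a set \<times> 'a set set"

abbreviation verts :: "'a sgraph \<Rightarrow> 'a set" where
  "verts G \<equiv> fst G"

abbreviation edges :: "'a sgraph \<Rightarrow> 'a set set" where
  "edges G \<equiv> snd G"

definition simple_graph :: "'a sgraph \<Rightarrow> bool" where
  "simple_graph G \<longleftrightarrow> finite (verts G) \<and> (\<forall>e\<in>edges G. e \<subseteq> verts G \<and> card e = 2)"

definition subgraph :: "'a sgraph \<Rightarrow> 'a sgraph \<Rightarrow> bool" where
  "subgraph H G \<longleftrightarrow> simple_graph H \<and> verts H \<subseteq> verts G \<and> edges H \<subseteq> edges G"

definition isomorphic :: "'a sgraph \<Rightarrow> 'b sgraph \<Rightarrow> bool" where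
  "isomorphic G H \<longleftrightarrow>
     (\<exists>f. bij_betw f (verts G) (verts H) \<and>
          (\<forall>u\<in>verts G. \<forall>v\<in>verts G. {u, v} \<in> edges G \<longleftrightarrow> {f u, f v} \<in> edges H))"

definition is_free :: "'b sgraph set \<Rightarrow> 'a sgraph \<Rightarrow> bool" where
  "is_free \<F> G \<longleftrightarrow> (\<nexists>H F. subgraph H G \<and> F \<in> \<F> \<and> isomorphic H F)"

definition copies :: "'b sgraph \<Rightarrow> 'a sgraph \<Rightarrow> 'a sgraph set" where
  "copies T G = {H. subgraph H G \<and> isomorphic H T}"

text \<open>Finite graphs are considered up to isomorphism, so vertices may be taken to be natural numbers.
  The set of values below is always finite (\<open>finite_copy_counts\<close>); it is nonempty whenever
  some graph on \<open>n\<close> vertices is \<open>\<F>\<close>-free.\<close>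

definition copy_counts :: "nat \<Rightarrow> 'b sgraph \<Rightarrow> 'c sgraph set \<Rightarrow> nat set" where
  "copy_counts n T \<F> =
     {card (copies T G) | G :: nat sgraph. simple_graph G \<and> card (verts G) = n \<and> is_free \<F> G}"

definition ex :: "nat \<Rightarrow> 'b sgraph \<Rightarrow> 'c sgraph set \<Rightarrow> nat" where
  "ex n T \<F> = Max (copy_counts n T \<F>)"

definition complete_graph :: "nat \<Rightarrow> nat sgraph" where
  "complete_graph s = ({..<s}, {e. e \<subseteq> {..<s} \<and> card e = 2})"

definition path_graph :: "nat \<Rightarrow> nat sgraph" where
  "path_graph m = ({..<m}, {{i, Suc i} | i. Suc i < m})"

definition components :: "'a sgraph \<Rightarrow> 'a sgraph set" where
  "components G =
     {(C, {e \<in> edges G. e \<subseteq> C}) | C. \<exists>u\<in>verts G. C = {v \<in> verts G. (u, v) \<in> {(x, y). {x, y} \<in> edges G}\<^sup>*}}"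

text \<open>The case \<open>m = 1\<close> is an isolated vertex.\<close>

definition linear_forest :: "'a sgraph \<Rightarrow> bool" where
  "linear_forest G \<longleftrightarrow>
     simple_graph G \<and> (\<forall>C\<in>components G. \<exists>m\<ge>1. isomorphic C (path_graph m))"

definition linear_forests :: "nat \<Rightarrow> nat \<Rightarrow> nat sgraph set" where
  "linear_forests n k = {F. linear_forest F \<and> card (verts F) = n \<and> card (edges F) = k}"

lemma finite_copy_counts: "finite (copy_counts n T \<F>)"
proof (rule finite_subset)
  show "copy_counts n T \<F> \<subseteq> {.. 2 ^ n * 2 ^ 2 ^ n}"
  proof
    fix c assume "c \<in> copy_counts n T \<F>"
    then obtain G :: "nat sgraph" where G: "simple_graph G" "card (verts G) = n"
      and c: "c = card (copies T G)"
      by (auto simp: copy_counts_def)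
    have fin: "finite (verts G)" using G by (simp add: simple_graph_def)
    have "copies T G \<subseteq> Pow (verts G) \<times> Pow (Pow (verts G))"
      using G by (force simp: copies_def subgraph_def simple_graph_def)
    then have "c \<le> card (Pow (verts G) \<times> Pow (Pow (verts G)))"
      unfolding c using fin by (intro card_mono) auto
    also have "\<dots> = 2 ^ n * 2 ^ 2 ^ n"
      using fin G by (simp add: card_cartesian_product card_Pow)
    finally show "c \<in> {.. 2 ^ n * 2 ^ 2 ^ n}" by simp
  qed
qed simp

end

theory Submission imports Defs begin

text \<open>A graph on \<open>n\<close> vertices contains a linear forest with \<open>k\<close> edges iff some ordering of its vertices has
  at least \<open>k\<close> adjacent consecutive pairs. Shifting (replacing edges \<open>{j, x}\<close> by \<open>{i, x}\<close> for \<open>i < j\<close>) does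
  not decrease the number of \<open>s\<close>-cliques, and any ordering can be rearranged (swap \<open>i\<close> and \<open>j\<close> and/or
  reverse the segment between them) so that the unshifted graph has at least as many adjacencies. So one
  may take an extremal graph on \<open>{0, ..., n - 1}\<close> that is invariant under all shifts. If it contained all
  \<open>{x, k - x}\<close> with \<open>2 * x < k\<close>, the zigzag \<open>k, 0, k - 1, 1, ...\<close> would be a path with \<open>k\<close> edges; if
  \<open>{x, k - x}\<close> is missing, then every edge \<open>{a, b}\<close> with \<open>a < b\<close> has \<open>a < x\<close> or \<open>b < k - x\<close>. The clique
  count of that maximal graph is convex in \<open>x\<close>, so it is largest at \<open>x = 0\<close> or
  \<open>x = (k - 1) div 2\<close>.\<close>

section \<open>Adjacencies along an ordering\<close>

fun adjacencies :: "'a set set \<Rightarrow> 'a list \<Rightarrow> nat" where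
  "adjacencies E (x # y # zs) = of_bool ({x, y} \<in> E) + adjacencies E (y # zs)"
| "adjacencies E _ = 0"

text \<open>The edge set of the path through the list. A linear forest is handled as a subset of the
  \<open>steps\<close> of an ordering of its vertices.\<close>

fun steps :: "'a list \<Rightarrow> 'a set set" where
  "steps (x # y # zs) = insert {x, y} (steps (y # zs))"
| "steps _ = {}"

lemma adjacencies_Cons:
  "adjacencies E (x # xs) = of_bool (xs \<noteq> [] \<and> {x, hd xs} \<in> E) + adjacencies E xs"
  by (cases xs) auto

lemma adjacencies_append:
  "adjacencies E (xs @ ys) = adjacencies E xs + adjacencies E ys
     + of_bool (xs \<noteq> [] \<and> ys \<noteq> [] \<and> {last xs, hd ys} \<in> E)"
  by (induction xs) (auto simp: adjacencies_Cons hd_append)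

lemma adjacencies_rev: "adjacencies E (rev xs) = adjacencies E xs"
  by (induction xs) (auto simp: adjacencies_Cons adjacencies_append last_rev insert_commute)

lemma adjacencies_map_mono:
  assumes "\<And>x y. x \<in> set xs \<Longrightarrow> y \<in> set xs \<Longrightarrow> {x, y} \<in> E \<Longrightarrow> {g x, g y} \<in> E'"
  shows "adjacencies E xs \<le> adjacencies E' (map g xs)"
  using assms by (induction xs rule: steps.induct) (auto intro!: add_mono)

lemma adjacencies_cong:
  assumes "\<And>x y. x \<in> set xs \<Longrightarrow> y \<in> set xs \<Longrightarrow> {x, y} \<in> E \<longleftrightarrow> {x, y} \<in> E'"
  shows "adjacencies E xs = adjacencies E' xs"
  using assms by (induction xs rule: steps.induct) auto

lemma adjacencies_successively:
  assumes "successively (\<lambda>x y. {x, y} \<in> E) xs"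
  shows "length xs \<le> Suc (adjacencies E xs)"
  using assms by (induction xs rule: steps.induct) auto

lemma steps_subset: "e \<in> steps xs \<Longrightarrow> e \<subseteq> set xs"
  by (induction xs rule: steps.induct) auto

lemma finite_steps [simp]: "finite (steps xs)"
  by (induction xs rule: steps.induct) auto

lemma steps_append: "steps xs \<union> steps ys \<subseteq> steps (xs @ ys)"
  by (induction xs rule: steps.induct) (cases ys; auto)+

lemma steps_conv_nth: "steps xs = {{xs ! i, xs ! Suc i} | i. Suc i < length xs}"
proof (induction xs rule: steps.induct)
  case (1 x y zs)
  show ?case (is "_ = ?R")
  proof (intro equalityI subsetI)
    fix e assume "e \<in> ?R"
    then obtain i where "Suc i < length (x # y # zs)" "e = {(x # y # zs) ! i, (x # y # zs) ! Suc i}"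
      by blast
    then show "e \<in> steps (x # y # zs)"
      unfolding steps.simps 1 by (cases i) auto
  next
    fix e assume "e \<in> steps (x # y # zs)"
    then consider "e = {x, y}" | i where "Suc i < length (y # zs)" "e = {(y # zs) ! i, (y # zs) ! Suc i}"
      unfolding steps.simps 1 by blast
    then show "e \<in> ?R"
    proof cases
      case 1
      then show ?thesis by (auto intro!: exI[of _ 0])
    next
      case (2 i)
      then show ?thesis by (auto intro!: exI[of _ "Suc i"])
    qed
  qed
qed auto

text \<open>In a list without repetitions no step occurs twice, so counting positions and counting
  edges agree.\<close>

lemma card_Int_steps: "distinct xs \<Longrightarrow> card (E \<inter> steps xs) = adjacencies E xs"
proof (induction xs rule: steps.induct)
  case (1 x y zs)
  then have "{x, y} \<notin> steps (y # zs)"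
    using steps_subset[of "{x, y}" "y # zs"] by auto
  with 1 show ?case by (auto simp: Int_insert_right)
qed auto

section \<open>Linear forests as orderings\<close>

text \<open>The inverse of the isomorphism lists \<open>C\<close> in the order
  \<open>0, ..., m - 1\<close> of the path, which turns path edges into consecutive
  positions.\<close>

lemma path_component_ordering:
  assumes "isomorphic (C, {e \<in> E. e \<subseteq> C}) (path_graph m)" and "\<And>e. e \<in> E \<Longrightarrow> card e = 2"
  shows "\<exists>xs. distinct xs \<and> set xs = C \<and> {e \<in> E. e \<subseteq> C} \<subseteq> steps xs"
proof -
  obtain f where f: "bij_betw f C {..<m}"
    and fE: "\<And>u v. u \<in> C \<Longrightarrow> v \<in> C \<Longrightarrow> {u, v} \<in> E \<longleftrightarrow> {f u, f v} \<in> {{i, Suc i} | i. Suc i < m}"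
    using assms(1) unfolding isomorphic_def path_graph_def by auto
  define g where "g = inv_into C f"
  define xs where "xs = map g [0..<m]"
  have g: "bij_betw g {..<m} C" unfolding g_def by (rule bij_betw_inv_into[OF f])
  have gf: "g (f u) = u" if "u \<in> C" for u
    using that f unfolding g_def bij_betw_def by simp
  have "distinct xs" "set xs = C"
    using g unfolding xs_def bij_betw_def by (auto simp: distinct_map atLeast0LessThan)
  moreover have "e \<in> steps xs" if e: "e \<in> E" "e \<subseteq> C" for e
  proof -
    obtain u v where uv: "e = {u, v}" using assms(2)[OF e(1)] by (auto simp: card_2_iff)
    with e have "u \<in> C" "v \<in> C" by auto
    with fE e uv obtain i where i: "{f u, f v} = {i, Suc i}" "Suc i < m" by auto
    have "e = g ` {f u, f v}" using uv gf \<open>u \<in> C\<close> \<open>v \<in> C\<close> by auto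
    then have "e = {xs ! i, xs ! Suc i}" using i by (simp add: xs_def)
    moreover have "Suc i < length xs" using i by (simp add: xs_def)
    ultimately show ?thesis unfolding steps_conv_nth by blast
  qed
  ultimately show ?thesis by blast
qed

text \<open>The orderings of the parts are concatenated. Every step inside a block survives; the
  extra step at a junction does no harm because only an inclusion is claimed.\<close>

lemma concat_orderings:
  assumes "finite D" and "pairwise disjnt D"
    and "\<And>C. C \<in> D \<Longrightarrow> \<exists>xs. distinct xs \<and> set xs = C \<and> {e \<in> E. e \<subseteq> C} \<subseteq> steps xs"
  shows "\<exists>xs. distinct xs \<and> set xs = \<Union>D \<and> (\<forall>C\<in>D. {e \<in> E. e \<subseteq> C} \<subseteq> steps xs)"
  using assms
proof (induction D rule: finite_induct)
  case empty
  then show ?case by auto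
next
  case (insert C D)
  obtain xs where xs: "distinct xs" "set xs = \<Union>D" "\<forall>C\<in>D. {e \<in> E. e \<subseteq> C} \<subseteq> steps xs"
    using insert.IH insert.prems by (auto simp: pairwise_insert)
  obtain ys where ys: "distinct ys" "set ys = C" "{e \<in> E. e \<subseteq> C} \<subseteq> steps ys"
    using insert.prems(2)[of C] by auto
  have "C \<inter> \<Union>D = {}"
    using insert.prems(1) insert.hyps by (auto simp: pairwise_insert disjnt_def)
  then have "distinct (ys @ xs)" "set (ys @ xs) = \<Union>(insert C D)"
    using xs ys by auto
  moreover have "\<forall>C'\<in>insert C D. {e \<in> E. e \<subseteq> C'} \<subseteq> steps (ys @ xs)"
    using xs(3) ys(3) steps_append[of ys xs] by blast
  ultimately show ?case by blast
qed

text \<open>Adjacency is symmetric, so reachability is an equivalence relation and its classes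
  partition the vertices. Each edge lies inside one class, hence concatenating the orderings of the
  path components catches all edges.\<close>

lemma linear_forest_ordering:
  assumes "linear_forest F"
  shows "\<exists>xs. distinct xs \<and> set xs = verts F \<and> edges F \<subseteq> steps xs"
proof -
  let ?V = "verts F" and ?E = "edges F"
  define R where "R = {(x, y). {x, y} \<in> ?E}"
  define comp where "comp u = {v \<in> ?V. (u, v) \<in> R\<^sup>*}" for u
  have fin: "finite ?V" and E: "\<And>e. e \<in> ?E \<Longrightarrow> e \<subseteq> ?V \<and> card e = 2"
    and paths: "\<And>C. C \<in> components F \<Longrightarrow> \<exists>m\<ge>1. isomorphic C (path_graph m)"
    using assms by (auto simp: linear_forest_def simple_graph_def)
  have "sym R" by (auto simp: R_def sym_def insert_commute)
  then have symR: "sym (R\<^sup>*)" by (rule sym_rtrancl)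
  have comp_eq: "comp u = comp v" if "(u, v) \<in> R\<^sup>*" for u v
    using that symD[OF symR that] unfolding comp_def by (auto intro: rtrancl_trans)
  have "pairwise disjnt (comp ` ?V)"
  proof (rule pairwiseI)
    fix C C' assume "C \<in> comp ` ?V" "C' \<in> comp ` ?V" "C \<noteq> C'"
    then obtain u v where uv: "C = comp u" "C' = comp v" by auto
    have "w \<notin> C'" if "w \<in> C" for w
    proof
      assume "w \<in> C'"
      with that have "(u, w) \<in> R\<^sup>*" "(v, w) \<in> R\<^sup>*"
        unfolding uv by (auto simp: comp_def)
      then have "comp u = comp w" "comp v = comp w" using comp_eq by blast+
      then show False using \<open>C \<noteq> C'\<close> uv by simp
    qed
    then show "disjnt C C'" by (auto simp: disjnt_def)
  qed
  moreover have "\<exists>xs. distinct xs \<and> set xs = C \<and> {e \<in> ?E. e \<subseteq> C} \<subseteq> steps xs"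
    if "C \<in> comp ` ?V" for C
  proof -
    have "(C, {e \<in> ?E. e \<subseteq> C}) \<in> components F"
      using that unfolding components_def comp_def R_def by auto
    then show ?thesis using paths path_component_ordering E by blast
  qed
  ultimately have "\<exists>xs. distinct xs \<and> set xs = \<Union>(comp ` ?V)
      \<and> (\<forall>C\<in>comp ` ?V. {e \<in> ?E. e \<subseteq> C} \<subseteq> steps xs)"
    by (intro concat_orderings finite_imageI fin)
  then obtain xs where xs: "distinct xs" "set xs = \<Union>(comp ` ?V)"
    "\<forall>C\<in>comp ` ?V. {e \<in> ?E. e \<subseteq> C} \<subseteq> steps xs"
    by (elim exE conjE)
  have "\<Union>(comp ` ?V) = ?V" by (auto simp: comp_def)
  moreover have "e \<in> steps xs" if e: "e \<in> ?E" for e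
  proof -
    obtain u v where uv: "e = {u, v}" using E[OF e] by (auto simp: card_2_iff)
    with e E have "u \<in> ?V" "v \<in> ?V" "(u, v) \<in> R" by (auto simp: R_def)
    then have "e \<subseteq> comp u" using uv by (auto simp: comp_def)
    then show ?thesis using xs(3) \<open>u \<in> ?V\<close> e by blast
  qed
  ultimately show ?thesis using xs(1,2) by (intro exI[of _ xs]) auto
qed

text \<open>Removing steps from a path cuts it into runs of consecutive positions. The component of
  \<open>xs ! p\<close> is the longest run \<open>{l..h}\<close> around \<open>p\<close> in which
  every step is kept, and such a run is a path.\<close>

lemma linear_forest_sub_steps:
  assumes "distinct xs" and "E \<subseteq> steps xs"
  shows "linear_forest (set xs, E)"
  unfolding linear_forest_def
proof (intro conjI ballI)
  let ?n = "length xs"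
  have nth_eq: "xs ! i = xs ! j \<longleftrightarrow> i = j" if "i < ?n" "j < ?n" for i j
    using that assms(1) by (simp add: nth_eq_iff_index_eq)
  show "simple_graph (set xs, E)"
    unfolding simple_graph_def
  proof (intro conjI ballI)
    fix e assume "e \<in> edges (set xs, E)"
    then have e: "e \<in> steps xs" using assms(2) by auto
    then show "e \<subseteq> verts (set xs, E)" using steps_subset by auto
    from e obtain i where "e = {xs ! i, xs ! Suc i}" "Suc i < ?n"
      by (auto simp: steps_conv_nth)
    then show "card e = 2" using nth_eq by auto
  qed simp
  \<comment> \<open>Position \<open>i\<close> belongs to \<open>I\<close> when the step from
    \<open>i\<close> to \<open>Suc i\<close> is kept; by \<open>edge\<close> below, every edge of
    \<open>E\<close> within the list has this form.\<close>
  define I where "I = {i. Suc i < ?n \<and> {xs ! i, xs ! Suc i} \<in> E}"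
  define R where "R = {(x, y). {x, y} \<in> E}"
  have "sym (R\<^sup>*)" by (intro sym_rtrancl) (auto simp: R_def sym_def insert_commute)
  have edge: "{xs ! i, xs ! j} \<in> E \<longleftrightarrow> (j = Suc i \<and> i \<in> I) \<or> (i = Suc j \<and> j \<in> I)"
    if ij: "i < ?n" "j < ?n" for i j
  proof
    assume E: "{xs ! i, xs ! j} \<in> E"
    then obtain p where "{xs ! i, xs ! j} = {xs ! p, xs ! Suc p}" "Suc p < ?n"
      using assms(2) by (auto simp: steps_conv_nth)
    then have "i = p \<and> j = Suc p \<or> j = p \<and> i = Suc p"
      using ij nth_eq by (auto simp: doubleton_eq_iff)
    then show "(j = Suc i \<and> i \<in> I) \<or> (i = Suc j \<and> j \<in> I)"
      using E ij by (auto simp: I_def insert_commute)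
  qed (auto simp: I_def insert_commute)
  fix C assume "C \<in> components (set xs, E)"
  then obtain U p where p: "p < ?n" and C: "C = (U, {e \<in> E. e \<subseteq> U})"
    and U: "U = {v \<in> set xs. (xs ! p, v) \<in> R\<^sup>*}"
    by (auto simp: components_def R_def in_set_conv_nth)
  \<comment> \<open>The left end of the run. The empty interval makes \<open>p\<close> itself a
    candidate, here and for the right end \<open>h\<close>.\<close>
  define l where "l = (LEAST l. {l..<p} \<subseteq> I)"
  have l: "{l..<p} \<subseteq> I" unfolding l_def by (rule LeastI[of _ p]) simp
  have l_min: "l \<le> q" if "{q..<p} \<subseteq> I" for q unfolding l_def using that by (rule Least_le)
  have "l \<le> p" using l_min[of p] by simp
  define h where "h = (GREATEST h. {p..<h} \<subseteq> I \<and> h < ?n)"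
  have h: "{p..<h} \<subseteq> I \<and> h < ?n" unfolding h_def
    by (rule GreatestI_nat[of _ p ?n]) (use p in auto)
  have h_max: "q \<le> h" if "{p..<q} \<subseteq> I" "q < ?n" for q
    unfolding h_def by (rule Greatest_le_nat[of _ _ ?n]) (use that in auto)
  have "p \<le> h" using h_max[of p] p by simp
  have lh: "i \<in> I" if "l \<le> i" "i < h" for i using that l h by (cases "i < p") auto
  have "h \<notin> I"
  proof
    assume "h \<in> I"
    then have "{p..<Suc h} \<subseteq> I" "Suc h < ?n" using h by (auto simp: less_Suc_eq I_def)
    then show False using h_max[of "Suc h"] by simp
  qed
  \<comment> \<open>The step leading into \<open>l\<close> is missing by minimality; for
    \<open>l = 0\<close> the claim is vacuous. With \<open>h \<notin> I\<close> this closes off the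
    run on both sides.\<close>
  have l_out: "i \<notin> I" if "Suc i = l" for i
  proof
    assume "i \<in> I"
    have "q \<in> I" if "q \<in> {i..<p}" for q
      using that \<open>i \<in> I\<close> \<open>Suc i = l\<close> l by (cases "q = i") auto
    then have "{i..<p} \<subseteq> I" by blast
    then show False using l_min[of i] that by simp
  qed
  have reach: "(xs ! l, xs ! i) \<in> R\<^sup>*" if "l \<le> i" "i \<le> h" for i
    using that
  proof (induction i rule: dec_induct)
    case (step i)
    then have "(xs ! i, xs ! Suc i) \<in> R" using lh[of i] by (auto simp: R_def I_def)
    with step show ?case by (simp add: rtrancl.rtrancl_into_rtrancl)
  qed simp
  \<comment> \<open>An edge moves by exactly one position, and the steps leaving the run are
    missing, so no walk from \<open>p\<close> escapes.\<close>
  have stay: "\<exists>i. l \<le> i \<and> i \<le> h \<and> v = xs ! i" if "(xs ! p, v) \<in> R\<^sup>*" for v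
    using that
  proof (induction rule: rtrancl_induct)
    case base
    then show ?case using \<open>l \<le> p\<close> \<open>p \<le> h\<close> by blast
  next
    case (step v w)
    then obtain i where i: "l \<le> i" "i \<le> h" "v = xs ! i" by blast
    from step have "{v, w} \<in> E" by (simp add: R_def)
    moreover from this have "w \<in> set xs" using steps_subset assms(2) by blast
    then obtain j where j: "j < ?n" "w = xs ! j" by (auto simp: in_set_conv_nth)
    ultimately have "(j = Suc i \<and> i \<in> I) \<or> (i = Suc j \<and> j \<in> I)"
      using edge[of i j] i h by auto
    then have "l \<le> j \<and> j \<le> h"
      using i \<open>h \<notin> I\<close> l_out by (metis le_Suc_eq le_antisym not_less_eq_eq Suc_leD le_SucI)
    then show ?case using j by blast
  qed
  have U_eq: "U = (\<lambda>i. xs ! i) ` {l..h}"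
  proof (intro equalityI subsetI)
    fix v assume "v \<in> U"
    then show "v \<in> (\<lambda>i. xs ! i) ` {l..h}" using stay unfolding U by fastforce
  next
    fix v assume "v \<in> (\<lambda>i. xs ! i) ` {l..h}"
    then obtain i where i: "l \<le> i" "i \<le> h" "v = xs ! i" by auto
    have "(xs ! p, xs ! l) \<in> R\<^sup>*"
      using symD[OF \<open>sym (R\<^sup>*)\<close> reach] \<open>l \<le> p\<close> \<open>p \<le> h\<close> by blast
    then show "v \<in> U" unfolding U using reach[of i] i h by auto
  qed
  define m where "m = Suc (h - l)"
  define g where "g i = xs ! (l + i)" for i
  have "bij_betw g {..<m} U"
  proof (rule bij_betw_imageI)
    show "inj_on g {..<m}"
      unfolding inj_on_def g_def m_def using h nth_eq \<open>l \<le> p\<close> \<open>p \<le> h\<close> by auto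
    have "{l..h} = (\<lambda>i. l + i) ` {..<m}"
      using \<open>l \<le> p\<close> \<open>p \<le> h\<close> image_add_atLeastLessThan[of l 0 m]
      by (auto simp: m_def atLeast0LessThan)
    then show "g ` {..<m} = U" unfolding U_eq g_def by (simp add: image_image)
  qed
  then have f: "bij_betw (inv_into {..<m} g) U {..<m}" by (rule bij_betw_inv_into)
  have g_edge: "{g i, g j} \<in> E \<longleftrightarrow> {i, j} \<in> {{i, Suc i} | i. Suc i < m}" if "i < m" "j < m" for i j
  proof -
    have "{g i, g j} \<in> E \<longleftrightarrow> j = Suc i \<or> i = Suc j"
      using edge[of "l + i" "l + j"] lh that h \<open>l \<le> p\<close> \<open>p \<le> h\<close> by (auto simp: g_def m_def)
    also have "\<dots> \<longleftrightarrow> {i, j} \<in> {{i, Suc i} | i. Suc i < m}"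
      using that by (auto simp: doubleton_eq_iff)
    finally show ?thesis .
  qed
  have g_inv: "g (inv_into {..<m} g u) = u" "inv_into {..<m} g u < m" if "u \<in> U" for u
    using that \<open>bij_betw g {..<m} U\<close> f_inv_into_f[of u g "{..<m}"] inv_into_into[of u g "{..<m}"]
    by (auto simp: bij_betw_def)
  have "{u, v} \<in> E \<longleftrightarrow> {inv_into {..<m} g u, inv_into {..<m} g v} \<in> {{i, Suc i} | i. Suc i < m}"
    if "u \<in> U" "v \<in> U" for u v
    using g_edge[of "inv_into {..<m} g u" "inv_into {..<m} g v"] by (simp only: g_inv that)
  then have "isomorphic C (path_graph m)"
    unfolding isomorphic_def path_graph_def C by (intro exI[of _ "inv_into {..<m} g"] conjI) (use f in simp_all)
  moreover have "m \<ge> 1" by (simp add: m_def)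
  ultimately show "\<exists>m\<ge>1. isomorphic C (path_graph m)" by blast
qed

text \<open>Members of the family have as many vertices as \<open>G\<close>, so a forbidden copy
  spans \<open>G\<close>. Its ordering gives an ordering of \<open>verts G\<close> with at least
  \<open>k\<close> adjacencies; conversely \<open>k\<close> adjacent steps of an ordering form such
  a copy.\<close>

lemma is_free_linear_forests_iff:
  fixes G :: "nat sgraph"
  assumes G: "simple_graph G" "card (verts G) = n"
  shows "is_free (linear_forests n k) G \<longleftrightarrow>
    (\<forall>xs. distinct xs \<longrightarrow> set xs = verts G \<longrightarrow> adjacencies (edges G) xs < k)"
proof
  assume free: "is_free (linear_forests n k) G"
  show "\<forall>xs. distinct xs \<longrightarrow> set xs = verts G \<longrightarrow> adjacencies (edges G) xs < k"
  proof (intro allI impI, rule ccontr)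
    fix xs assume xs: "distinct xs" "set xs = verts G" "\<not> adjacencies (edges G) xs < k"
    then have "k \<le> card (edges G \<inter> steps xs)" by (simp add: card_Int_steps)
    \<comment> \<open>There may be more than \<open>k\<close> adjacencies, but the family asks for
      exactly \<open>k\<close> edges. All \<open>n\<close> vertices are retained, some possibly
      isolated.\<close>
    then obtain E where E: "E \<subseteq> edges G \<inter> steps xs" "card E = k"
      by (meson obtain_subset_with_card_n)
    have lf: "linear_forest (verts G, E)"
      using linear_forest_sub_steps[of xs E] xs E by auto
    then have "(verts G, E) \<in> linear_forests n k" using G E by (simp add: linear_forests_def)
    moreover have "subgraph (verts G, E) G"
      using lf E by (auto simp: subgraph_def linear_forest_def)
    moreover have "isomorphic (verts G, E) (verts G, E)"
      unfolding isomorphic_def by (rule exI[of _ id]) auto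
    ultimately show False using free unfolding is_free_def by blast
  qed
next
  assume few: "\<forall>xs. distinct xs \<longrightarrow> set xs = verts G \<longrightarrow> adjacencies (edges G) xs < k"
  show "is_free (linear_forests n k) G"
    unfolding is_free_def
  proof clarify
    fix H F assume HG: "subgraph H G" and F: "F \<in> linear_forests n k" and "isomorphic H F"
    then obtain f where f: "bij_betw f (verts H) (verts F)"
      and fE: "\<forall>u\<in>verts H. \<forall>v\<in>verts H. {u, v} \<in> edges H \<longleftrightarrow> {f u, f v} \<in> edges F"
      by (auto simp: isomorphic_def)
    from F have lf: "linear_forest F" and cF: "card (verts F) = n" "card (edges F) = k"
      by (auto simp: linear_forests_def)
    obtain xs where xs: "distinct xs" "set xs = verts F" "edges F \<subseteq> steps xs"
      using linear_forest_ordering[OF lf] by blast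
    define g where "g = inv_into (verts H) f"
    have g: "bij_betw g (verts F) (verts H)" unfolding g_def by (rule bij_betw_inv_into[OF f])
    have fg: "f (g x) = x" if "x \<in> verts F" for x
      using that f unfolding g_def bij_betw_def by (simp add: f_inv_into_f)
    have "verts H = verts G"
      using HG G bij_betw_same_card[OF f] cF
      by (intro card_subset_eq) (auto simp: subgraph_def simple_graph_def)
    then have "distinct (map g xs)" "set (map g xs) = verts G"
      using g xs by (auto simp: distinct_map bij_betw_def)
    moreover have "k = adjacencies (edges F) xs"
      using card_Int_steps[OF xs(1), of "edges F"] xs(3) cF by (simp add: Int_absorb2)
    moreover have "adjacencies (edges F) xs \<le> adjacencies (edges G) (map g xs)"
    proof (rule adjacencies_map_mono)
      fix x y assume "x \<in> set xs" "y \<in> set xs" "{x, y} \<in> edges F"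
      moreover from this have "g x \<in> verts H" "g y \<in> verts H"
        using g xs(2) by (auto simp: bij_betw_def)
      ultimately have "{g x, g y} \<in> edges H"
        using fE fg xs(2) by simp
      then show "{g x, g y} \<in> edges G" using HG by (auto simp: subgraph_def)
    qed
    ultimately show False using few by fastforce
  qed
qed

section \<open>Cliques and shifting\<close>

definition cliques :: "'a set set \<Rightarrow> 'a set \<Rightarrow> nat \<Rightarrow> 'a set set" where
  "cliques E V s = {K. K \<subseteq> V \<and> card K = s \<and> (\<forall>x\<in>K. \<forall>y\<in>K. x \<noteq> y \<longrightarrow> {x, y} \<in> E)}"

lemma finite_cliques: "finite V \<Longrightarrow> finite (cliques E V s)"
  by (rule finite_subset[of _ "Pow V"]) (auto simp: cliques_def)

text \<open>All pairs of distinct vertices of a copy are edges, so a copy is determined by its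
  vertex set; this gives a bijection with the cliques of size \<open>s\<close>.\<close>

lemma copies_complete_graph:
  assumes "simple_graph G"
  shows "card (copies (complete_graph s) G) = card (cliques (edges G) (verts G) s)"
proof -
  have fin: "finite (verts G)" using assms by (simp add: simple_graph_def)
  let ?c = "\<lambda>K. (K, {e. e \<subseteq> K \<and> card e = 2})"
  have "copies (complete_graph s) G = ?c ` cliques (edges G) (verts G) s"
  proof (intro equalityI subsetI)
    fix H assume H: "H \<in> copies (complete_graph s) G"
    then have HG: "subgraph H G" by (simp add: copies_def)
    from H obtain f where f: "bij_betw f (verts H) {..<s}"
      and fE: "\<And>u v. u \<in> verts H \<Longrightarrow> v \<in> verts H \<Longrightarrow>
        {u, v} \<in> edges H \<longleftrightarrow> {f u, f v} \<subseteq> {..<s} \<and> card {f u, f v} = 2"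
      by (auto simp: copies_def isomorphic_def complete_graph_def)
    have E: "{u, v} \<in> edges H" if "u \<in> verts H" "v \<in> verts H" "u \<noteq> v" for u v
    proof -
      have "f u \<noteq> f v" using that f by (auto simp: bij_betw_def inj_on_def)
      moreover have "f u < s" "f v < s" using that f by (auto simp: bij_betw_def)
      ultimately show ?thesis using fE that by auto
    qed
    then have "edges H = {e. e \<subseteq> verts H \<and> card e = 2}"
      using HG by (auto simp: subgraph_def simple_graph_def card_2_iff)
    then have "H = ?c (verts H)" by (simp add: prod_eq_iff)
    moreover have "verts H \<in> cliques (edges G) (verts G) s"
      using HG E bij_betw_same_card[OF f] by (auto simp: cliques_def subgraph_def)
    ultimately show "H \<in> ?c ` cliques (edges G) (verts G) s" by (rule image_eqI)
  next
    fix H assume "H \<in> ?c ` cliques (edges G) (verts G) s"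
    then obtain K where K: "K \<in> cliques (edges G) (verts G) s" and H: "H = ?c K" by auto
    have finK: "finite K" using K fin by (auto simp: cliques_def intro: finite_subset)
    then obtain f where f: "bij_betw f K {..<s}"
      using K by (auto simp: cliques_def lessThan_atLeast0 intro: ex_bij_betw_finite_nat[THEN exE])
    have "isomorphic H (complete_graph s)"
      unfolding isomorphic_def complete_graph_def H
    proof (intro exI[of _ f] conjI ballI)
      fix u v assume "u \<in> verts (?c K)" "v \<in> verts (?c K)"
      then show "{u, v} \<in> edges (?c K) \<longleftrightarrow> {f u, f v} \<in> edges ({..<s}, {e. e \<subseteq> {..<s} \<and> card e = 2})"
        using f by (auto simp: bij_betw_def inj_on_def card_insert_if)
    qed (use f in simp)
    moreover have "subgraph H G"
      using K finK by (auto simp: H subgraph_def simple_graph_def cliques_def card_2_iff)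
    ultimately show "H \<in> copies (complete_graph s) G" by (simp add: copies_def)
  qed
  moreover have "inj_on ?c (cliques (edges G) (verts G) s)" by (auto simp: inj_on_def)
  ultimately show ?thesis by (simp add: card_image)
qed

text \<open>The usual compression of set families. An edge stays put when its image is already
  present, which makes the map injective on \<open>E\<close>.\<close>

definition shift_edge :: "'a \<Rightarrow> 'a \<Rightarrow> 'a set set \<Rightarrow> 'a set \<Rightarrow> 'a set" where
  "shift_edge i j E e =
     (if j \<in> e \<and> i \<notin> e \<and> insert i (e - {j}) \<notin> E then insert i (e - {j}) else e)"

definition shift :: "'a \<Rightarrow> 'a \<Rightarrow> 'a set set \<Rightarrow> 'a set set" where
  "shift i j E = shift_edge i j E ` E"

lemma inj_on_shift_edge: "inj_on (shift_edge i j E) E"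
  unfolding inj_on_def shift_edge_def by (auto split: if_splits)

text \<open>Sets containing exactly one of \<open>i\<close> and \<open>j\<close> come in twins that
  differ by exchanging \<open>i\<close> and \<open>j\<close>. The shift keeps the number of twins
  present and prefers the one with \<open>i\<close>; all other sets are untouched.\<close>

lemma mem_shift_iff:
  assumes "i \<noteq> j"
  shows "e \<in> shift i j E \<longleftrightarrow>
    (if i \<in> e \<and> j \<notin> e then e \<in> E \<or> insert j (e - {i}) \<in> E
     else if j \<in> e \<and> i \<notin> e then e \<in> E \<and> insert i (e - {j}) \<in> E else e \<in> E)" (is "_ = ?r")
proof
  assume "e \<in> shift i j E"
  then obtain d where d: "d \<in> E" "e = shift_edge i j E d" by (auto simp: shift_def)
  show ?r
  proof (cases "j \<in> d \<and> i \<notin> d \<and> insert i (d - {j}) \<notin> E")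
    case True
    then have e: "e = insert i (d - {j})" using d by (simp add: shift_edge_def)
    with True have "insert j (e - {i}) = d" by auto
    with e d assms show ?thesis by auto
  next
    case False
    then have "e = d" using d by (auto simp: shift_edge_def)
    with d False show ?thesis by auto
  qed
next
  assume r: ?r
  show "e \<in> shift i j E"
  proof (cases "e \<in> E \<and> (j \<in> e \<longrightarrow> i \<notin> e \<longrightarrow> insert i (e - {j}) \<in> E)")
    case True
    then have "e = shift_edge i j E e" by (auto simp: shift_edge_def)
    then show ?thesis using True by (auto simp: shift_def)
  next
    case False
    with r have e: "i \<in> e" "j \<notin> e" "e \<notin> E" "insert j (e - {i}) \<in> E" by (auto split: if_splits)
    then have "insert i (insert j (e - {i}) - {j}) = e" by auto
    then have "shift_edge i j E (insert j (e - {i})) = e" using e assms by (auto simp: shift_edge_def)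
    then show ?thesis using e unfolding shift_def by (metis imageI)
  qed
qed

lemma shift_i_iff:
  assumes "i \<noteq> j" "x \<noteq> i" "x \<noteq> j"
  shows "{i, x} \<in> shift i j E \<longleftrightarrow> {i, x} \<in> E \<or> {j, x} \<in> E"
    and "{x, i} \<in> shift i j E \<longleftrightarrow> {i, x} \<in> E \<or> {j, x} \<in> E"
proof -
  have "{i, x} - {i} = {x}" using assms by auto
  then show "{i, x} \<in> shift i j E \<longleftrightarrow> {i, x} \<in> E \<or> {j, x} \<in> E"
    using assms by (simp add: mem_shift_iff)
  then show "{x, i} \<in> shift i j E \<longleftrightarrow> {i, x} \<in> E \<or> {j, x} \<in> E"
    by (simp add: insert_commute)
qed

lemma shift_j_iff:
  assumes "i \<noteq> j" "x \<noteq> i" "x \<noteq> j"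
  shows "{j, x} \<in> shift i j E \<longleftrightarrow> {i, x} \<in> E \<and> {j, x} \<in> E"
    and "{x, j} \<in> shift i j E \<longleftrightarrow> {i, x} \<in> E \<and> {j, x} \<in> E"
proof -
  have "{j, x} - {j} = {x}" using assms by auto
  then show "{j, x} \<in> shift i j E \<longleftrightarrow> {i, x} \<in> E \<and> {j, x} \<in> E"
    using assms by (auto simp: mem_shift_iff)
  then show "{x, j} \<in> shift i j E \<longleftrightarrow> {i, x} \<in> E \<and> {j, x} \<in> E"
    by (simp add: insert_commute)
qed

lemma shift_other_iff:
  assumes "i \<noteq> j" "i \<in> e \<longleftrightarrow> j \<in> e"
  shows "e \<in> shift i j E \<longleftrightarrow> e \<in> E"
  using assms by (auto simp: mem_shift_iff)

text \<open>In the shifted graph, \<open>i\<close> sees the union and \<open>j\<close> the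
  intersection of the two former neighbourhoods, apart from \<open>i\<close> and \<open>j\<close>
  themselves. So in \<open>A, i, B, j, C\<close> adjacencies of \<open>j\<close> to
  \<open>last B\<close> and \<open>hd C\<close> hold in \<open>E\<close> for both vertices and
  survive any swap. It remains to put a neighbour of \<open>last A\<close> next to \<open>A\<close>,
  and to reverse \<open>B\<close> if \<open>hd B\<close> is adjacent only to the other
  vertex.\<close>

lemma shift_adjacencies:
  assumes "i \<noteq> j" "distinct xs" "i \<in> set xs" "j \<in> set xs"
  shows "\<exists>ys. distinct ys \<and> set ys = set xs \<and> adjacencies (shift i j E) xs \<le> adjacencies E ys"
proof -
  let ?S = "shift i j E"
  have main: "\<exists>ys. distinct ys \<and> set ys = set xs \<and> adjacencies ?S xs \<le> adjacencies E ys"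
    if xs: "xs = A @ i # B @ j # C" and dist: "distinct xs" for A B C xs
  proof -
    have same: "adjacencies ?S zs = adjacencies E zs" if "i \<notin> set zs" "j \<notin> set zs" for zs
      using that assms(1) by (intro adjacencies_cong shift_other_iff) auto
    have ABC: "adjacencies ?S A = adjacencies E A" "adjacencies ?S B = adjacencies E B"
      "adjacencies ?S C = adjacencies E C"
      using dist by (auto simp: xs intro!: same)
    have ij: "{i, j} \<in> ?S \<longleftrightarrow> {i, j} \<in> E" "{j, i} \<in> ?S \<longleftrightarrow> {i, j} \<in> E"
      using assms(1) shift_other_iff[of i j "{i, j}"] by (auto simp: insert_commute)
    have A: "last A \<noteq> i \<and> last A \<noteq> j" if "A \<noteq> []"
      using that dist last_in_set[of A] by (auto simp: xs)
    have B: "hd B \<noteq> i \<and> hd B \<noteq> j \<and> last B \<noteq> i \<and> last B \<noteq> j" if "B \<noteq> []"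
      using that dist last_in_set[of B] hd_in_set[of B] by (auto simp: xs)
    have C: "hd C \<noteq> i \<and> hd C \<noteq> j" if "C \<noteq> []"
      using that dist hd_in_set[of C] by (auto simp: xs)
    \<comment> \<open>The four candidates: swap \<open>i\<close> and \<open>j\<close> or not,
      reverse the middle segment or not.\<close>
    let ?Y = "{A @ i # B @ j # C, A @ j # B @ i # C, A @ i # rev B @ j # C, A @ j # rev B @ i # C}"
    have "\<forall>ys\<in>?Y. distinct ys \<and> set ys = set xs" using dist by (auto simp: xs)
    moreover have "\<exists>ys\<in>?Y. adjacencies ?S xs \<le> adjacencies E ys"
    proof -
      define p where "p a x \<longleftrightarrow> {a, x} \<in> E" for a x
      have S: "{i, x} \<in> ?S \<longleftrightarrow> p i x \<or> p j x" "{x, i} \<in> ?S \<longleftrightarrow> p i x \<or> p j x"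
        "{j, x} \<in> ?S \<longleftrightarrow> p i x \<and> p j x" "{x, j} \<in> ?S \<longleftrightarrow> p i x \<and> p j x" if "x \<noteq> i" "x \<noteq> j" for x
        using that assms(1) by (simp_all add: shift_i_iff shift_j_iff p_def)
      let ?a = "\<lambda>u. of_bool (A \<noteq> [] \<and> p u (last A)) :: nat"
      let ?c = "\<lambda>u. of_bool (C \<noteq> [] \<and> p u (hd C)) :: nat"
      let ?k = "adjacencies E A + adjacencies E B + adjacencies E C"
      have AS: "A \<noteq> [] \<and> {last A, i} \<in> ?S \<longleftrightarrow> A \<noteq> [] \<and> (p i (last A) \<or> p j (last A))"
        using A S by auto
      have CS: "C \<noteq> [] \<and> {j, hd C} \<in> ?S \<longleftrightarrow> C \<noteq> [] \<and> (p i (hd C) \<and> p j (hd C))"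
        using C S by auto
      show ?thesis
      proof (cases "B = []")
        case True
        have "adjacencies ?S xs = ?k + of_bool (p i j)
            + of_bool (A \<noteq> [] \<and> (p i (last A) \<or> p j (last A)))
            + of_bool (C \<noteq> [] \<and> (p i (hd C) \<and> p j (hd C)))"
          using AS CS by (simp add: xs True adjacencies_append adjacencies_Cons ABC ij p_def)
        moreover have "adjacencies E (A @ u # B @ v # C) = ?k + of_bool (p u v) + ?a u + ?c v" for u v
          by (simp add: True adjacencies_append adjacencies_Cons p_def insert_commute)
        moreover have "p j i \<longleftrightarrow> p i j" by (simp add: p_def insert_commute)
        ultimately show ?thesis by (auto simp: of_bool_def)
      next
        case False
        let ?f = "\<lambda>u. of_bool (p u (hd B)) :: nat" and ?l = "\<lambda>u. of_bool (p u (last B)) :: nat"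
        have "adjacencies ?S xs = ?k
            + of_bool (A \<noteq> [] \<and> (p i (last A) \<or> p j (last A)))
            + of_bool (C \<noteq> [] \<and> (p i (hd C) \<and> p j (hd C)))
            + of_bool (p i (hd B) \<or> p j (hd B)) + of_bool (p i (last B) \<and> p j (last B))"
          using AS CS B S by (simp add: xs False adjacencies_append adjacencies_Cons ABC)
        moreover have "adjacencies E (A @ u # B @ v # C) = ?k + ?a u + ?f u + ?l v + ?c v" for u v
          by (simp add: False adjacencies_append adjacencies_Cons p_def insert_commute)
        moreover have "adjacencies E (A @ u # rev B @ v # C) = ?k + ?a u + ?l u + ?f v + ?c v" for u v
          by (simp add: False adjacencies_append adjacencies_Cons adjacencies_rev hd_rev last_rev
              p_def insert_commute)
        ultimately show ?thesis
          by (cases "p i (last A) \<or> A = []"; cases "p i (hd B)"; cases "p j (last A)"; cases "p j (hd B)")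
            (auto simp: of_bool_def)
      qed
    qed
    ultimately show ?thesis by blast
  qed
  obtain A D where xs: "xs = A @ i # D" using assms(3) by (meson split_list)
  show ?thesis
  proof (cases "j \<in> set D")
    case True
    then obtain B C where "D = B @ j # C" by (meson split_list)
    then show ?thesis using main xs assms by blast
  next
    case False
    then have "j \<in> set A" using assms xs by auto
    then obtain B C where "A = B @ j # C" by (meson split_list)
    \<comment> \<open>The shift treats \<open>i\<close> and \<open>j\<close> differently, so the
      case where \<open>j\<close> comes first is reduced to \<open>main\<close> by reversing the
      whole list, which preserves adjacencies.\<close>
    then have "rev xs = rev D @ i # rev C @ j # rev B" using xs by simp
    then obtain ys where "distinct ys" "set ys = set (rev xs)" "adjacencies ?S (rev xs) \<le> adjacencies E ys"
      using main[of "rev xs"] assms(2) by (metis distinct_rev)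
    then show ?thesis by (auto simp: adjacencies_rev)
  qed
qed

text \<open>A clique destroyed by the shift contains \<open>j\<close> but not \<open>i\<close>, and
  replacing \<open>j\<close> by \<open>i\<close> yields a clique of the shifted graph that was none
  before. Surviving cliques are fixed. The map is injective: moved cliques land outside the old
  ones, and the replacement can be undone.\<close>

lemma card_cliques_shift:
  assumes "i \<noteq> j" "i \<in> V" "finite V"
  shows "card (cliques E V s) \<le> card (cliques (shift i j E) V s)"
proof (rule card_inj_on_le[where f = "\<lambda>K. if K \<in> cliques (shift i j E) V s then K else insert i (K - {j})"])
  let ?S = "shift i j E"
  have moved: "j \<in> K \<and> i \<notin> K \<and> insert i (K - {j}) \<in> cliques ?S V s \<and> insert i (K - {j}) \<notin> cliques E V s"
    if K: "K \<in> cliques E V s" "K \<notin> cliques ?S V s" for K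
  proof -
    have E: "{x, y} \<in> E" if "x \<in> K" "y \<in> K" "x \<noteq> y" for x y
      using that K by (auto simp: cliques_def)
    have "K \<subseteq> V" "card K = s" using K by (auto simp: cliques_def)
    obtain x y where xy: "x \<in> K" "y \<in> K" "x \<noteq> y" "{x, y} \<notin> ?S"
      using K by (auto simp: cliques_def)
    then have e: "j \<in> {x, y}" "i \<notin> {x, y}" "insert i ({x, y} - {j}) \<notin> E"
      using E[of x y] assms(1) by (auto simp: mem_shift_iff split: if_splits)
    \<comment> \<open>A destroyed edge of \<open>K\<close> must be \<open>{j, z}\<close> with
      \<open>{i, z}\<close> missing. This \<open>z\<close> shows both that \<open>i\<close> is
      outside \<open>K\<close> and that the new set is no clique of \<open>E\<close>.\<close>
    then obtain z where z: "z \<in> K" "z \<noteq> j" "z \<noteq> i" "{i, z} \<notin> E"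
      using xy by (metis doubleton_eq_iff insertCI insert_Diff_if insert_absorb2 insert_commute
          insert_iff singletonD Diff_insert_absorb empty_iff)
    have "j \<in> K" using e xy by auto
    have "i \<notin> K" using E[of i z] z by auto
    have "finite K" using \<open>K \<subseteq> V\<close> assms(3) by (rule finite_subset)
    then have "card (insert i (K - {j})) = s"
      using \<open>j \<in> K\<close> \<open>i \<notin> K\<close> \<open>card K = s\<close> by (metis Diff_iff card_Suc_Diff1 card_insert_disjoint finite_Diff)
    moreover have "{u, v} \<in> ?S" if "u \<in> insert i (K - {j})" "v \<in> insert i (K - {j})" "u \<noteq> v" for u v
    proof (cases "u = i \<or> v = i")
      case True
      then show ?thesis
        using that assms(1) \<open>j \<in> K\<close> \<open>i \<notin> K\<close> E by (auto simp: shift_i_iff)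
    next
      case False
      then show ?thesis using that assms(1) E shift_other_iff[of i j "{u, v}" E] by auto
    qed
    moreover have "insert i (K - {j}) \<notin> cliques E V s"
      using z by (auto simp: cliques_def)
    ultimately show ?thesis
      using \<open>j \<in> K\<close> \<open>i \<notin> K\<close> \<open>K \<subseteq> V\<close> assms(2) by (auto simp: cliques_def)
  qed
  show "inj_on (\<lambda>K. if K \<in> cliques ?S V s then K else insert i (K - {j})) (cliques E V s)"
  proof (rule inj_onI)
    fix K L assume KL: "K \<in> cliques E V s" "L \<in> cliques E V s"
      and eq: "(if K \<in> cliques ?S V s then K else insert i (K - {j}))
        = (if L \<in> cliques ?S V s then L else insert i (L - {j}))"
    have "K = L" if "K \<notin> cliques ?S V s" "L \<notin> cliques ?S V s"
    proof -
      have *: "insert j (insert i (M - {j}) - {i}) = M" if "M \<in> cliques E V s" "M \<notin> cliques ?S V s" for M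
        using moved[OF that] by auto
      have "insert i (K - {j}) = insert i (L - {j})" using eq that by simp
      then show ?thesis using *[OF KL(1) that(1)] *[OF KL(2) that(2)] by metis
    qed
    then show "K = L" using moved[of K] moved[of L] KL eq by (metis (full_types))
  qed
  show "(\<lambda>K. if K \<in> cliques ?S V s then K else insert i (K - {j})) ` cliques E V s \<subseteq> cliques ?S V s"
    using moved by auto
qed (rule finite_cliques[OF assms(3)])

text \<open>Every shift with \<open>i < j\<close> that changes \<open>E\<close> lowers the sum of
  all endpoints over all edges, so repeated shifting ends at an invariant edge set. Each shift
  preserves the bound on adjacencies and loses no cliques.\<close>

lemma shifted_family:
  fixes E :: "nat set set"
  assumes "E \<subseteq> {e. e \<subseteq> {..<n} \<and> card e = 2}"
    and "\<And>xs. distinct xs \<Longrightarrow> set xs = {..<n} \<Longrightarrow> adjacencies E xs < k"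
  obtains E' where "E' \<subseteq> {e. e \<subseteq> {..<n} \<and> card e = 2}"
    and "\<And>xs. distinct xs \<Longrightarrow> set xs = {..<n} \<Longrightarrow> adjacencies E' xs < k"
    and "\<And>i j x. {j, x} \<in> E' \<Longrightarrow> i < j \<Longrightarrow> x \<noteq> i \<Longrightarrow> {i, x} \<in> E'"
    and "card (cliques E {..<n} s) \<le> card (cliques E' {..<n} s)"
  using assms
proof (induction "\<Sum>e\<in>E. \<Sum>e" arbitrary: E thesis rule: less_induct)
  case less
  show ?case
  proof (cases "\<forall>i j. i < j \<longrightarrow> j < n \<longrightarrow> shift i j E = E")
    case True
    have "{i, x} \<in> E" if "{j, x} \<in> E" "i < j" "x \<noteq> i" for i j x
    proof -
      have "{j, x} \<subseteq> {..<n} \<and> card {j, x} = 2" using that(1) less.prems(2) by blast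
      then have "j < n" "x \<noteq> j" by auto
      with True that show ?thesis using shift_j_iff(1)[of i j x E] by auto
    qed
    then show ?thesis by (intro less.prems(1)[OF less.prems(2,3)]) auto
  next
    case False
    then obtain i j where ij: "i < j" "j < n" "shift i j E \<noteq> E" by blast
    let ?f = "shift_edge i j E"
    have finE: "finite E" by (rule finite_subset[OF less.prems(2)]) simp
    have fin: "finite e" if "e \<in> E" for e
      using that less.prems(2) by (auto intro: finite_subset)
    have moved: "\<Sum>(?f e) < \<Sum>e" if "e \<in> E" "?f e \<noteq> e" for e
    proof -
      have e: "j \<in> e" "i \<notin> e" "?f e = insert i (e - {j})"
        using that by (auto simp: shift_edge_def split: if_splits)
      have "\<Sum>(?f e) = i + \<Sum>(e - {j})" using e fin[OF that(1)] by simp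
      also have "\<dots> < j + \<Sum>(e - {j})" using ij by simp
      also have "\<dots> = \<Sum>e" using e fin[OF that(1)] by (simp add: sum.remove)
      finally show ?thesis .
    qed
    \<comment> \<open>Injectivity of \<open>shift_edge\<close> on \<open>E\<close> allows the sum to
      be compared edge by edge.\<close>
    have "(\<Sum>e\<in>shift i j E. \<Sum>e) = (\<Sum>e\<in>E. \<Sum>(?f e))"
      unfolding shift_def by (simp add: sum.reindex[OF inj_on_shift_edge])
    also have "\<dots> < (\<Sum>e\<in>E. \<Sum>e)"
    proof (rule sum_strict_mono_ex1[OF finE])
      show "\<forall>e\<in>E. \<Sum>(?f e) \<le> \<Sum>e" using moved by (metis less_imp_le order_refl)
      show "\<exists>e\<in>E. \<Sum>(?f e) < \<Sum>e"
      proof (rule ccontr)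
        assume "\<not> ?thesis"
        then have "\<forall>e\<in>E. ?f e = e" using moved by blast
        then show False using ij(3) by (simp add: shift_def)
      qed
    qed
    finally have smaller: "(\<Sum>e\<in>shift i j E. \<Sum>e) < (\<Sum>e\<in>E. \<Sum>e)" .
    have sub: "shift i j E \<subseteq> {e. e \<subseteq> {..<n} \<and> card e = 2}"
    proof
      fix e assume "e \<in> shift i j E"
      then obtain d where d: "d \<in> E" "e = ?f d" by (auto simp: shift_def)
      then have "d \<subseteq> {..<n}" "card d = 2" "finite d" using less.prems(2) fin by auto
      moreover have "card (insert i (d - {j})) = card d" if "j \<in> d" "i \<notin> d"
        using that \<open>finite d\<close> by (metis Diff_iff card_Suc_Diff1 card_insert_disjoint finite_Diff)
      ultimately show "e \<in> {e. e \<subseteq> {..<n} \<and> card e = 2}"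
        using d ij by (auto simp: shift_edge_def)
    qed
    have few: "adjacencies (shift i j E) xs < k" if "distinct xs" "set xs = {..<n}" for xs
    proof -
      have "i \<noteq> j" "i \<in> set xs" "j \<in> set xs" using ij that by auto
      then obtain ys where "distinct ys" "set ys = set xs" "adjacencies (shift i j E) xs \<le> adjacencies E ys"
        using shift_adjacencies \<open>distinct xs\<close> by metis
      then show ?thesis using less.prems(3)[of ys] that by simp
    qed
    have more: "card (cliques E {..<n} s) \<le> card (cliques (shift i j E) {..<n} s)"
      using ij by (intro card_cliques_shift) auto
    show ?thesis
    proof (rule less.hyps[OF smaller _ sub few])
      fix E' assume "E' \<subseteq> {e. e \<subseteq> {..<n} \<and> card e = 2}"
        "\<And>xs. distinct xs \<Longrightarrow> set xs = {..<n} \<Longrightarrow> adjacencies E' xs < k"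
        "\<And>i j x. {j, x} \<in> E' \<Longrightarrow> i < j \<Longrightarrow> x \<noteq> i \<Longrightarrow> {i, x} \<in> E'"
        "card (cliques (shift i j E) {..<n} s) \<le> card (cliques E' {..<n} s)"
      then show ?thesis
        using more by (intro less.prems(1)[of E'] order_trans[OF more]) assumption+
    qed
  qed
qed

text \<open>Neighbours in \<open>k, 0, k - 1, 1, ...\<close> have sums \<open>k\<close> and
  \<open>k - 1\<close> alternately. Pairs of sum \<open>k\<close> are edges by assumption, and those
  of sum \<open>k - 1\<close> arise from them by lowering the larger end.\<close>

lemma zigzag_ordering:
  fixes E :: "nat set set"
  assumes shifted: "\<And>i j x. {j, x} \<in> E \<Longrightarrow> i < j \<Longrightarrow> x \<noteq> i \<Longrightarrow> {i, x} \<in> E"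
    and E: "\<And>x. 2 * x < k \<Longrightarrow> {x, k - x} \<in> E" and "k < n"
  shows "\<exists>xs. distinct xs \<and> set xs = {..<n} \<and> k \<le> adjacencies E xs"
proof -
  define z where "z m = (if even m then k - m div 2 else m div 2)" for m
  let ?zs = "map z [0..<Suc k]"
  have inj: "inj_on z {0..<Suc k}"
  proof (rule inj_onI)
    fix a b assume "a \<in> {0..<Suc k}" "b \<in> {0..<Suc k}" "z a = z b"
    then show "a = b" unfolding z_def
      by (cases "even a"; cases "even b") (auto elim!: evenE oddE)
  qed
  have "z ` {0..<Suc k} \<subseteq> {0..<Suc k}" by (auto simp: z_def)
  then have "z ` {0..<Suc k} = {0..<Suc k}"
    using inj by (intro card_subset_eq) (auto simp: card_image)
  then have "set ?zs = {0..<Suc k}" by (simp del: upt_Suc)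
  moreover have "distinct ?zs" using inj by (simp add: distinct_map del: upt_Suc)
  moreover have "successively (\<lambda>x y. {x, y} \<in> E) ?zs"
    unfolding successively_conv_nth
  proof (intro allI impI)
    fix m assume "Suc m < length ?zs"
    then have m: "m < k" by simp
    have "{z m, z (Suc m)} \<in> E"
    proof (cases "even m")
      case True
      then obtain q where "m = 2 * q" by (elim evenE)
      then show ?thesis using E[of q] m by (simp add: z_def insert_commute)
    next
      case False
      then obtain q where q: "m = 2 * q + 1" by (elim oddE)
      then have "{k - q, q} \<in> E" using E[of q] m by (simp add: insert_commute)
      \<comment> \<open>From \<open>2 * q + 1 < k\<close> the lowered end \<open>k - Suc q\<close>
        still exceeds \<open>q\<close>, so the pair does not collapse.\<close>
      then have "{k - Suc q, q} \<in> E" by (rule shifted) (use m q in auto)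
      then show ?thesis using q by (simp add: z_def insert_commute)
    qed
    then show "{?zs ! m, ?zs ! Suc m} \<in> E" using m by (simp del: upt_Suc)
  qed
  then have "k \<le> adjacencies E ?zs" using adjacencies_successively[of E ?zs] by simp
  \<comment> \<open>The vertices above \<open>k\<close> are appended to obtain an ordering of all
    vertices; this can only add adjacencies.\<close>
  ultimately have "distinct (?zs @ [Suc k..<n])" "set (?zs @ [Suc k..<n]) = {..<n}"
    "k \<le> adjacencies E (?zs @ [Suc k..<n])"
    using \<open>k < n\<close> by (auto simp: adjacencies_append simp del: upt_Suc)
  then show ?thesis by blast
qed

section \<open>The extremal graphs\<close>

text \<open>For \<open>2 * x < k\<close> and \<open>k \<le> n\<close>: a clique on the first
  \<open>k - x\<close> vertices, of which the first \<open>x\<close> are joined to all other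
  vertices too. The case \<open>x = 0\<close> is the complete graph on \<open>k\<close> vertices
  plus isolated ones.\<close>

definition threshold_edges :: "nat \<Rightarrow> nat \<Rightarrow> nat \<Rightarrow> nat set set" where
  "threshold_edges n k x = {{a, b} | a b. a < b \<and> b < n \<and> (a < x \<or> b < k - x)}"

lemma mem_threshold_edges:
  "a < b \<Longrightarrow> {a, b} \<in> threshold_edges n k x \<longleftrightarrow> b < n \<and> (a < x \<or> b < k - x)"
  by (auto simp: threshold_edges_def doubleton_eq_iff)

lemma simple_threshold: "simple_graph ({..<n}, threshold_edges n k x)"
  by (auto simp: simple_graph_def threshold_edges_def)

text \<open>A vertex \<open>b\<close> with \<open>b \<ge> k - x\<close> is adjacent only to vertices
  below \<open>x\<close>, so a clique reaching beyond \<open>{..<k - x}\<close> consists of one such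
  \<open>b\<close> and vertices below \<open>x\<close>.\<close>

lemma cliques_threshold_edges:
  assumes "2 * x < k" "k \<le> n" "s \<ge> 1"
  shows "cliques (threshold_edges n k x) {..<n} s =
    {K. K \<subseteq> {..<k - x} \<and> card K = s}
    \<union> (\<lambda>(b, K). insert b K) ` ({k - x..<n} \<times> {K. K \<subseteq> {..<x} \<and> card K = s - 1})"
    (is "?L = ?A \<union> ?B")
proof (intro equalityI subsetI)
  fix K assume K: "K \<in> ?L"
  show "K \<in> ?A \<union> ?B"
  proof (cases "K \<subseteq> {..<k - x}")
    case True
    then show ?thesis using K by (auto simp: cliques_def)
  next
    case False
    then obtain b where b: "b \<in> K" "k - x \<le> b" by (meson lessThan_iff not_less subsetI)
    have "a < x" if "a \<in> K" "a \<noteq> b" for a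
    proof -
      have e: "{a, b} \<in> threshold_edges n k x" using K b that by (auto simp: cliques_def)
      show ?thesis
      proof (cases "a < b")
        case True
        then show ?thesis using e b by (simp add: mem_threshold_edges)
      next
        case False
        then have "b < a" "{b, a} \<in> threshold_edges n k x"
          using that e by (auto simp: insert_commute)
        then show ?thesis using b(2) assms(1) by (auto simp: mem_threshold_edges)
      qed
    qed
    then have "K - {b} \<subseteq> {..<x}" by auto
    moreover have "card (K - {b}) = s - 1" "b < n" "K = insert b (K - {b})"
      using b K by (auto simp: cliques_def)
    ultimately show ?thesis using b by (auto intro!: image_eqI[of _ _ "(b, K - {b})"])
  qed
next
  have clique: "K \<in> ?L" if "K \<subseteq> {..<n}" "card K = s"
    "\<And>a b. a \<in> K \<Longrightarrow> b \<in> K \<Longrightarrow> a < b \<Longrightarrow> a < x \<or> b < k - x" for K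
    unfolding cliques_def
  proof (intro CollectI conjI ballI impI that)
    fix a b assume "a \<in> K" "b \<in> K" "a \<noteq> b"
    then show "{a, b} \<in> threshold_edges n k x"
      using that mem_threshold_edges[of a b n k x] mem_threshold_edges[of b a n k x]
      by (cases a b rule: linorder_cases) (auto simp: insert_commute)
  qed
  fix K assume "K \<in> ?A \<union> ?B"
  then show "K \<in> ?L"
  proof
    assume "K \<in> ?A"
    then show ?thesis using assms by (intro clique) auto
  next
    assume "K \<in> ?B"
    then obtain b K' where K: "K = insert b K'" "k - x \<le> b" "b < n" "K' \<subseteq> {..<x}" "card K' = s - 1"
      by auto
    then have "finite K'" "b \<notin> K'" using assms by (auto intro: finite_subset)
    then show ?thesis using K assms by (intro clique) auto
  qed
qed

text \<open>In the second family \<open>b\<close> is recovered as the only element that is at least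
  \<open>k - x\<close>; the first family has no such elements, so the two are disjoint.\<close>

lemma card_cliques_threshold_edges:
  assumes "2 * x < k" "k \<le> n" "s \<ge> 1"
  shows "card (cliques (threshold_edges n k x) {..<n} s) =
    (k - x choose s) + (n - (k - x)) * (x choose (s - 1))"
proof -
  let ?A = "{K. K \<subseteq> {..<k - x} \<and> card K = s}"
  let ?D = "{k - x..<n} \<times> {K. K \<subseteq> {..<x} \<and> card K = s - 1}"
  have "inj_on (\<lambda>(b, K). insert b K) ?D"
  proof (rule inj_onI, clarify)
    fix b K c L assume "b \<in> {k - x..<n}" "c \<in> {k - x..<n}" "K \<subseteq> {..<x}" "L \<subseteq> {..<x}"
      and eq: "insert b K = insert c L"
    then have "b \<notin> L" "c \<notin> K" "b \<notin> K" "c \<notin> L" using assms by auto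
    with eq show "b = c \<and> K = L" by (metis insertE insertI1 insert_ident)
  qed
  then have "card ((\<lambda>(b, K). insert b K) ` ?D) = (n - (k - x)) * (x choose (s - 1))"
    by (simp add: card_image card_cartesian_product n_subsets)
  moreover have "card ?A = (k - x choose s)" by (simp add: n_subsets)
  moreover have "?A \<inter> (\<lambda>(b, K). insert b K) ` ?D = {}" by auto
  moreover have "finite ?A" "finite ((\<lambda>(b, K). insert b K) ` ?D)" by auto
  ultimately show ?thesis
    unfolding cliques_threshold_edges[OF assms] by (simp add: card_Un_disjoint)
qed

text \<open>Charging 2 to each vertex below \<open>x\<close> and 1 to each of the other \<open>k - 2 * x\<close> vertices below
  \<open>k - x\<close> pays for all adjacencies; the two indicator terms make the induction go through.\<close>

lemma adjacencies_threshold_le: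
  assumes "2 * x < k"
  defines "w \<equiv> \<lambda>v. if v < x then 2 else if v < k - x then 1 else (0 :: nat)"
  shows "adjacencies (threshold_edges n k x) xs + of_bool (\<exists>v\<in>set xs. x \<le> v \<and> v < k - x)
    + of_bool (xs \<noteq> [] \<and> hd xs < x) \<le> (\<Sum>v\<leftarrow>xs. w v)"
proof (induction xs rule: steps.induct)
  case (1 a b zs)
  have "a < x \<or> b < x \<or> (a < k - x \<and> b < k - x)" if "{a, b} \<in> threshold_edges n k x"
    using that by (auto simp: threshold_edges_def doubleton_eq_iff)
  with 1 assms show ?case
    by (cases "a < x"; cases "b < x"; cases "{a, b} \<in> threshold_edges n k x"; cases "a < k - x"; cases "b < k - x")
      (auto simp: of_bool_def split: if_splits)
qed (use assms in auto)

text \<open>The total charge is \<open>2 * x + (k - 2 * x) = k\<close>.\<close>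

lemma adjacencies_threshold_less:
  assumes "2 * x < k" "k \<le> n" "distinct xs" "set xs = {..<n}"
  shows "adjacencies (threshold_edges n k x) xs < k"
proof -
  let ?w = "\<lambda>v. if v < x then 2 else if v < k - x then 1 else (0 :: nat)"
  have "(\<Sum>v\<leftarrow>xs. ?w v) = (\<Sum>v\<in>{..<n}. ?w v)"
    using assms by (simp add: sum_list_distinct_conv_sum_set)
  also have "\<dots> = (\<Sum>v\<in>{..<x} \<union> {x..<k - x}. ?w v)"
  proof (rule sum.mono_neutral_right)
    show "{..<x} \<union> {x..<k - x} \<subseteq> {..<n}" using assms(1,2) by auto
    show "\<forall>v\<in>{..<n} - ({..<x} \<union> {x..<k - x}). ?w v = 0" by auto
  qed simp
  also have "\<dots> = (\<Sum>v\<in>{..<x}. ?w v) + (\<Sum>v\<in>{x..<k - x}. ?w v)"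
    by (rule sum.union_disjoint) auto
  also have "\<dots> = (\<Sum>v\<in>{..<x}. 2) + (\<Sum>v\<in>{x..<k - x}. 1)"
    by (intro arg_cong2[where f = "(+)"] sum.cong) auto
  also have "\<dots> = k" using assms by simp
  finally have "(\<Sum>v\<leftarrow>xs. ?w v) = k" .
  \<comment> \<open>Since \<open>x < k - x\<close>, vertex \<open>x\<close> has charge 1. The first
    indicator is therefore 1, which makes the bound strict.\<close>
  moreover have "\<exists>v\<in>set xs. x \<le> v \<and> v < k - x"
    using assms by (intro bexI[of _ x]) auto
  ultimately show ?thesis
    using adjacencies_threshold_le[OF assms(1), of n xs] by simp
qed

text \<open>After relabelling by \<open>{..<n}\<close> and shifting, the zigzag must fail at some
  pair \<open>{x, k - x}\<close>; this \<open>x\<close> is the witness.\<close>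

lemma card_cliques_le_threshold:
  fixes G :: "nat sgraph"
  assumes G: "simple_graph G" "card (verts G) = n" and "k < n" "s \<ge> 1"
    and free: "is_free (linear_forests n k) G"
  obtains x where "2 * x < k"
    and "card (cliques (edges G) (verts G) s) \<le> (k - x choose s) + (n - (k - x)) * (x choose (s - 1))"
proof -
  have "finite (verts G)" using G by (simp add: simple_graph_def)
  then obtain v where v: "bij_betw v {..<n} (verts G)"
    using ex_bij_betw_nat_finite G(2) by (metis lessThan_atLeast0)
  define E where "E = {e. e \<subseteq> {..<n} \<and> card e = 2 \<and> v ` e \<in> edges G}"
  have few: "adjacencies E xs < k" if xs: "distinct xs" "set xs = {..<n}" for xs
  proof -
    have "adjacencies E xs \<le> adjacencies (edges G) (map v xs)"
      by (rule adjacencies_map_mono) (auto simp: E_def)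
    also have "\<dots> < k"
      using free xs v unfolding is_free_linear_forests_iff[OF G]
      by (auto simp: bij_betw_def distinct_map)
    finally show ?thesis .
  qed
  have "E \<subseteq> {e. e \<subseteq> {..<n} \<and> card e = 2}" by (auto simp: E_def)
  then obtain E' where E': "E' \<subseteq> {e. e \<subseteq> {..<n} \<and> card e = 2}"
    and few': "\<And>xs. distinct xs \<Longrightarrow> set xs = {..<n} \<Longrightarrow> adjacencies E' xs < k"
    and shifted: "\<And>i j x. {j, x} \<in> E' \<Longrightarrow> i < j \<Longrightarrow> x \<noteq> i \<Longrightarrow> {i, x} \<in> E'"
    and le: "card (cliques E {..<n} s) \<le> card (cliques E' {..<n} s)"
    using shifted_family[of E n k s] few by blast
  obtain x where x: "2 * x < k" "{x, k - x} \<notin> E'"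
    using zigzag_ordering[of E' k n] shifted few' \<open>k < n\<close> by (metis not_less)
  \<comment> \<open>Otherwise shifting would lower \<open>{a, b}\<close> first to
    \<open>{x, b}\<close> and then to the missing pair \<open>{x, k - x}\<close>.\<close>
  have "a < x \<or> b < k - x" if "{a, b} \<in> E'" "a < b" for a b
  proof (rule ccontr)
    assume "\<not> (a < x \<or> b < k - x)"
    then have ab: "x \<le> a" "k - x \<le> b" by auto
    then have "{x, b} \<in> E'"
      using shifted[of a b x] that x by (cases "a = x") auto
    then have "{b, x} \<in> E'" by (simp add: insert_commute)
    then have "{k - x, x} \<in> E'"
      using shifted[of b x "k - x"] ab x by (cases "b = k - x") auto
    with x show False by (simp add: insert_commute)
  qed
  moreover have "\<exists>a b. e = {a, b} \<and> a < b \<and> b < n" if e: "e \<in> E'" for e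
  proof -
    have "card e = 2" "e \<subseteq> {..<n}" using e E' by auto
    then obtain a b where "e = {a, b}" "a \<noteq> b" "a < n" "b < n" by (auto simp: card_2_iff)
    then show ?thesis by (metis insert_commute linorder_neqE_nat)
  qed
  ultimately have "E' \<subseteq> threshold_edges n k x"
    unfolding threshold_edges_def by blast
  then have "cliques E' {..<n} s \<subseteq> cliques (threshold_edges n k x) {..<n} s"
    by (auto simp: cliques_def)
  then have "card (cliques E' {..<n} s) \<le> (k - x choose s) + (n - (k - x)) * (x choose (s - 1))"
    using x \<open>k < n\<close> \<open>s \<ge> 1\<close>
    by (subst card_cliques_threshold_edges[symmetric]) (auto intro!: card_mono finite_cliques)
  moreover have "card (cliques (edges G) (verts G) s) \<le> card (cliques E {..<n} s)"
  proof (rule surj_card_le[where f = "image v"])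
    show "finite (cliques E {..<n} s)" by (simp add: finite_cliques)
    show "cliques (edges G) (verts G) s \<subseteq> image v ` cliques E {..<n} s"
    proof
      fix K assume K: "K \<in> cliques (edges G) (verts G) s"
      define L where "L = {i. i < n \<and> v i \<in> K}"
      have "K \<subseteq> v ` {..<n}" using K v by (auto simp: cliques_def bij_betw_def)
      then have im: "v ` L = K" by (auto simp: L_def)
      have inj: "inj_on v {..<n}" using v by (simp add: bij_betw_def)
      then have "inj_on v L" by (rule inj_on_subset) (auto simp: L_def)
      then have "card L = s" using im K by (auto simp: cliques_def dest: card_image)
      moreover have "{a, b} \<in> E" if "a \<in> L" "b \<in> L" "a \<noteq> b" for a b
      proof -
        have "v a \<noteq> v b" using that inj by (auto simp: L_def inj_on_def)
        then show ?thesis using that K by (auto simp: L_def E_def cliques_def)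
      qed
      ultimately have "L \<in> cliques E {..<n} s" by (auto simp: cliques_def L_def)
      then show "K \<in> image v ` cliques E {..<n} s" using im by blast
    qed
  qed
  ultimately show ?thesis using that[OF x(1)] le by linarith
qed

section \<open>Convexity\<close>

text \<open>If the increment at \<open>i\<close> is at most 0, so are all earlier ones and
  \<open>f i \<le> f 0\<close>; otherwise all later ones are positive and
  \<open>f i \<le> f t\<close>.\<close>

lemma convex_seq_le_max:
  fixes f :: "nat \<Rightarrow> int"
  assumes "\<And>i. Suc i < t \<Longrightarrow> f (Suc i) - f i \<le> f (Suc (Suc i)) - f (Suc i)" and "i \<le> t"
  shows "f i \<le> max (f 0) (f t)"
proof (cases "i = t")
  case False
  then have "i < t" using assms(2) by simp
  have mono: "f (Suc p) - f p \<le> f (Suc q) - f q" if "p \<le> q" "q < t" for p q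
    using that
  proof (induction q rule: dec_induct)
    case (step q)
    then show ?case using assms(1)[of q] by linarith
  qed simp
  show ?thesis
  proof (cases "f (Suc i) - f i \<le> 0")
    case True
    have "f j \<le> f 0" if "j \<le> i" for j
      using that
    proof (induction j)
      case (Suc j)
      then show ?case using mono[of j i] True \<open>i < t\<close> by simp
    qed simp
    then show ?thesis by (simp add: max.coboundedI1)
  next
    case False
    have "f i \<le> f j" if "i \<le> j" "j \<le> t" for j
      using that
    proof (induction j rule: dec_induct)
      case (step j)
      then show ?case using mono[of i j] False by simp
    qed simp
    then show ?thesis using assms(2) by (simp add: max.coboundedI2)
  qed
qed simp

lemma clique_count_le_max:
  assumes "s \<ge> 2" "k \<le> n" "2 * t < k" "x \<le> t"
  shows "(k - x choose s) + (n - (k - x)) * (x choose (s - 1))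
    \<le> max (k choose s) ((k - t choose s) + (n - (k - t)) * (t choose (s - 1)))"
proof -
  obtain r where s: "s = Suc (Suc r)" using assms(1) by (metis add_2_eq_Suc le_Suc_ex)
  define f where "f i = int ((k - i choose s) + (n - (k - i)) * (i choose (s - 1)))" for i
  \<comment> \<open>Pascal's rule applied to both binomials; writing \<open>s\<close> as
    \<open>Suc (Suc r)\<close> permits it for \<open>s - 1\<close> as well. The first two terms grow
    with \<open>i\<close> and the subtracted one falls, whence convexity. Integers are used since
    increments may be negative.\<close>
  have diff: "f (Suc i) - f i = int ((n - (k - i)) * (i choose r)) + int (Suc i choose Suc r)
      - int (k - Suc i choose Suc r)" if "i < t" for i
  proof -
    have m: "k - i = Suc (k - Suc i)" using assms(3) that by simp
    have "n - (k - Suc i) = Suc (n - (k - i))" using m assms(2) by simp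
    then show ?thesis by (simp add: f_def s m algebra_simps)
  qed
  have "f x \<le> max (f 0) (f t)"
  proof (rule convex_seq_le_max[OF _ assms(4)])
    fix i assume i: "Suc i < t"
    have "(n - (k - i)) * (i choose r) \<le> (n - (k - Suc i)) * (Suc i choose r)"
      by (intro mult_mono binomial_right_mono) auto
    moreover have "(Suc i choose Suc r) \<le> (Suc (Suc i) choose Suc r)"
      by (intro binomial_right_mono) auto
    moreover have "(k - Suc (Suc i) choose Suc r) \<le> (k - Suc i choose Suc r)"
      by (intro binomial_right_mono) auto
    ultimately show "f (Suc i) - f i \<le> f (Suc (Suc i)) - f (Suc i)"
      using diff[of i] diff[of "Suc i"] i by linarith
  qed
  moreover have "f 0 = int (k choose s)" by (simp add: f_def s)
  ultimately have "f x \<le> max (int (k choose s)) (f t)" by simp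
  then show ?thesis by (simp only: f_def of_nat_le_iff flip: of_nat_max)
qed

section \<open>Evaluation of the extremal number\<close>

theorem theorem1p5:
  fixes n k s :: nat
  assumes "s \<ge> 2" and "k \<ge> 1" and "n \<ge> k + 1"
  shows "ex n (complete_graph s) (linear_forests n k) =
    max (k choose s)
        ((nat \<lceil>(real k + 1) / 2\<rceil> choose s) +
         (n - nat \<lceil>(real k + 1) / 2\<rceil>) * (nat \<lfloor>(real k - 1) / 2\<rfloor> choose (s - 1)))"
proof -
  \<comment> \<open>The largest \<open>x\<close> with \<open>2 * x < k\<close>. It equals the floor
    in the formula, and \<open>k - t\<close> equals the ceiling.\<close>
  define t where "t = (k - 1) div 2"
  have t: "2 * t < k" "k \<le> 2 * t + 2" using assms(2) by (auto simp: t_def)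
  have "\<lfloor>(real k - 1) / 2\<rfloor> = int t" by (rule floor_unique) (use t in auto)
  then have floor: "nat \<lfloor>(real k - 1) / 2\<rfloor> = t" by simp
  have "\<lceil>(real k + 1) / 2\<rceil> = int (k - t)" by (rule ceiling_unique) (use t in auto)
  then have ceiling: "nat \<lceil>(real k + 1) / 2\<rceil> = k - t" by simp
  define c where "c x = (k - x choose s) + (n - (k - x)) * (x choose (s - 1))" for x
  \<comment> \<open>Here \<open>s - 1 > 0\<close>, so the second summand vanishes at
    \<open>x = 0\<close>.\<close>
  have c0: "c 0 = (k choose s)" using assms(1) by (simp add: c_def binomial_eq_0)
  have attained: "c x \<in> copy_counts n (complete_graph s) (linear_forests n k)" if "2 * x < k" for x
  proof -
    let ?G = "({..<n}, threshold_edges n k x)"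
    have "is_free (linear_forests n k) ?G"
      using adjacencies_threshold_less[OF that] assms(3)
      by (simp add: is_free_linear_forests_iff simple_threshold)
    moreover have "card (copies (complete_graph s) ?G) = c x"
      using card_cliques_threshold_edges[OF that] assms
      by (simp add: copies_complete_graph simple_threshold c_def)
    ultimately show ?thesis
      unfolding copy_counts_def using simple_threshold
      by (intro CollectI exI[of _ ?G]) simp
  qed
  have "ex n (complete_graph s) (linear_forests n k) = max (c 0) (c t)"
    unfolding ex_def
  proof (rule Max_eqI)
    show "finite (copy_counts n (complete_graph s) (linear_forests n k))"
      by (rule finite_copy_counts)
    show "max (c 0) (c t) \<in> copy_counts n (complete_graph s) (linear_forests n k)"
      using attained[of 0] attained[of t] t by (auto simp: max_def)
    fix m assume "m \<in> copy_counts n (complete_graph s) (linear_forests n k)"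
    then obtain G :: "nat sgraph" where G: "simple_graph G" "card (verts G) = n"
      "is_free (linear_forests n k) G" and m: "m = card (cliques (edges G) (verts G) s)"
      by (auto simp: copy_counts_def copies_complete_graph)
    obtain x where x: "2 * x < k" "m \<le> c x"
      using card_cliques_le_threshold[OF G(1,2) _ _ G(3), of s] assms unfolding m c_def by auto
    have "c x \<le> max (c 0) (c t)"
      using clique_count_le_max[of s k n t x] assms t x unfolding c0 by (simp add: c_def)
    with x show "m \<le> max (c 0) (c t)" by simp
  qed
  then show ?thesis unfolding c0 floor ceiling by (simp only: c_def)
qed

end
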